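(* Let $\Gamma$ be a valued tree with a splitting weighted edge $l$ corresponding to roots with different lengths, with endpoints $\alpha,\beta$, and let $\Gamma_1\ni\alpha$ and $\Gamma_2\ni\beta$ be the two graphs into which $\Gamma$ splits when the edge $l$ is deleted. Suppose that $\Gamma_2$ contains only one point (namely $\beta$). Then $$\mathcal X(\Gamma,\lambda)=-(\lambda+1)\,\mathcal X(\Gamma_1,\lambda)-\rho\,\lambda\,\mathcal X(\Gamma_1\backslash\alpha,\lambda),$$ where $\rho$ is the ratio of lengths of the roots corresponding to the endpoints $\alpha$ and $\beta$.
   Context: A valued graph has Cartan matrix $K=(k_{ij})$ with $k_{ii}=2$ and, for an edge between $i$ and $j$ with weights $(d_{ij},d_{ji})$, $k_{ij}=-d_{ij}$, $k_{ji}=-d_{ji}$ (and $k_{ij}=0$ if there is no edge). The matrix $K$ is symmetrizable: $k_{ij}=2(\alpha_i,\alpha_j)/(\alpha_i,\alpha_i)$ for a symmetric bilinear form on the span of the simple roots $\alpha_i$, and the simple roots at the two ends of a weighted edge are compared by their lengths with respect to this form. In the applications made in the source of this formula and of the more general splitting formula it comes from, the value taken for $\rho$ is $2$ for an edge of type $(1,2)$ or $(2,1)$ (for instance in $F_4$ and $B_n$) and $3$ for an edge of type $(1,3)$ or $(3,1)$ (in the extended diagrams of $G_2$). $\mathcal X(\Gamma,\lambda)=\det({\bf C}-\lambda I)$ is the characteristic polynomial of a Coxeter transformation ${\bf C}$ of $\Gamma$: the product of all simple reflections $\sigma_v(z)=z-(Kz)_v\alpha_v$, each taken once, in some order (for a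 tree or forest $\mathcal X$ does not depend on the order). $\Gamma_1\backslash\alpha$ is $\Gamma_1$ with the vertex $\alpha$ and its incident edges removed; $\mathcal X$ of the empty graph is $1$.
   Formalization: ρ is taken as the product of the two weights of l; it is shown to be the ratio (longer to shorter) of squared lengths of the roots when one weight is 1. For other weights the claim with the length ratio fails, e.g. one edge with weights (2,4) needs ρ=8, not 2. *)

theory Defs
  imports Complex_Main "Jordan_Normal_Form.Char_Poly"
begin

(* wt G i j is the weight d_ij; the edge {i, j} carries the pair (wt G i j, wt G j i), and
   weight 0 means that there is no edge.  Weights outside verts G are irrelevant. *)
record 'a valued_graph =
  verts :: "'a set"
  wt :: "'a \<Rightarrow> 'a \<Rightarrow> nat"

definition valued_graph :: "'a valued_graph \<Rightarrow> bool" where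
  "valued_graph G \<longleftrightarrow> finite (verts G) \<and>
     (\<forall>i\<in>verts G. wt G i i = 0) \<and>
     (\<forall>i\<in>verts G. \<forall>j\<in>verts G. wt G i j = 0 \<longleftrightarrow> wt G j i = 0)"

definition adjacent :: "'a valued_graph \<Rightarrow> 'a \<Rightarrow> 'a \<Rightarrow> bool" where
  "adjacent G i j \<longleftrightarrow> i \<in> verts G \<and> j \<in> verts G \<and> wt G i j \<noteq> 0"

definition connected_graph :: "'a valued_graph \<Rightarrow> bool" where
  "connected_graph G \<longleftrightarrow> verts G \<noteq> {} \<and> (\<forall>i\<in>verts G. \<forall>j\<in>verts G. (adjacent G)\<^sup>*\<^sup>* i j)"

definition acyclic_graph :: "'a valued_graph \<Rightarrow> bool" where
  "acyclic_graph G \<longleftrightarrow>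
     \<not> (\<exists>p. length p \<ge> 3 \<and> distinct p \<and> successively (adjacent G) p \<and> adjacent G (last p) (hd p))"

definition valued_tree :: "'a valued_graph \<Rightarrow> bool" where
  "valued_tree G \<longleftrightarrow> valued_graph G \<and> connected_graph G \<and> acyclic_graph G"

definition del_edge :: "'a valued_graph \<Rightarrow> 'a \<Rightarrow> 'a \<Rightarrow> 'a valued_graph" where
  "del_edge G a b = G\<lparr>wt := (\<lambda>i j. if {i, j} = {a, b} then 0 else wt G i j)\<rparr>"

definition del_vert :: "'a valued_graph \<Rightarrow> 'a \<Rightarrow> 'a valued_graph" where
  "del_vert G v = G\<lparr>verts := verts G - {v}\<rparr>"

definition component :: "'a valued_graph \<Rightarrow> 'a \<Rightarrow> 'a valued_graph" where
  "component G v = G\<lparr>verts := {u \<in> verts G. (adjacent G)\<^sup>*\<^sup>* v u}\<rparr>"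

definition splitting_edge :: "'a valued_graph \<Rightarrow> 'a \<Rightarrow> 'a \<Rightarrow> bool" where
  "splitting_edge G a b \<longleftrightarrow> adjacent G a b \<and> \<not> (adjacent (del_edge G a b))\<^sup>*\<^sup>* a b"

definition cartan :: "'a valued_graph \<Rightarrow> 'a \<Rightarrow> 'a \<Rightarrow> int" where
  "cartan G i j = (if i = j then 2 else - int (wt G i j))"

(* B is the Gram matrix, in the basis of simple roots, of a symmetric bilinear form
   symmetrizing the Cartan matrix.  Simple roots have positive squared length B i i, but the
   form need not be positive definite. *)
definition symmetrizing_form :: "'a valued_graph \<Rightarrow> ('a \<Rightarrow> 'a \<Rightarrow> real) \<Rightarrow> bool" where
  "symmetrizing_form G B \<longleftrightarrow>
     (\<forall>i\<in>verts G. B i i > 0) \<and>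
     (\<forall>i\<in>verts G. \<forall>j\<in>verts G. B i j = B j i) \<and>
     (\<forall>i\<in>verts G. \<forall>j\<in>verts G. real_of_int (cartan G i j) = 2 * B i j / B i i)"

(* Ratio of longer to shorter of the squared lengths (a, a): this is the normalization in which
   edges of type (1,2), (2,1) give 2 and edges of type (1,3), (3,1) give 3. *)
definition length_ratio :: "('a \<Rightarrow> 'a \<Rightarrow> real) \<Rightarrow> 'a \<Rightarrow> 'a \<Rightarrow> real" where
  "length_ratio B a b = max (B a a) (B b b) / min (B a a) (B b b)"

(* Vectors are given by their coordinates in the basis of simple roots. *)
definition simple_root :: "'a \<Rightarrow> 'a \<Rightarrow> real" where
  "simple_root v = (\<lambda>u. if u = v then 1 else 0)"

definition simple_reflection :: "'a valued_graph \<Rightarrow> 'a \<Rightarrow> ('a \<Rightarrow> real) \<Rightarrow> ('a \<Rightarrow> real)" where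
  "simple_reflection G v z =
     (\<lambda>u. z u - (\<Sum>w\<in>verts G. real_of_int (cartan G v w) * z w) * simple_root v u)"

definition vertex_order :: "'a valued_graph \<Rightarrow> 'a list \<Rightarrow> bool" where
  "vertex_order G vs \<longleftrightarrow> distinct vs \<and> set vs = verts G"

definition coxeter :: "'a valued_graph \<Rightarrow> 'a list \<Rightarrow> ('a \<Rightarrow> real) \<Rightarrow> ('a \<Rightarrow> real)" where
  "coxeter G vs = foldr (\<lambda>v f. simple_reflection G v \<circ> f) vs id"

(* vs is used both as the order of the reflections and to enumerate the basis of simple roots;
   the latter use does not affect the determinant below. *)
definition coxeter_mat :: "'a valued_graph \<Rightarrow> 'a list \<Rightarrow> real mat" where
  "coxeter_mat G vs =
     mat (length vs) (length vs) (\<lambda>(i, j). coxeter G vs (simple_root (vs ! j)) (vs ! i))"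

(* det (C - \<lambda> I) as a polynomial in \<lambda>.  The library's char_poly is det (\<lambda> I - C), which
   differs by the sign (-1)^n. *)
definition coxeter_poly :: "'a valued_graph \<Rightarrow> 'a list \<Rightarrow> real poly" where
  "coxeter_poly G vs =
     det (map_mat (\<lambda>c. [:c:]) (coxeter_mat G vs) - [:0, 1:] \<cdot>\<^sub>m 1\<^sub>m (length vs))"

end

theory Submission
  imports Defs "HOL-Combinatorics.Cycles"
begin

text \<open>
  Number the vertices in the order of the reflections and write the Cartan matrix as
  \<open>K = (I + L) + (I + U)\<close> with \<open>L\<close> strictly lower and \<open>U\<close> strictly upper triangular.  The reflections
  act from last to first, each one changing only its own coordinate, so the value written by the
  reflection at \<open>v\<close> is computed from old coordinates before \<open>v\<close> and new coordinates after \<open>v\<close>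
  (\<open>coxeter_nth\<close>).  This says that the Coxeter transformation \<open>C\<close> satisfies
  \<open>(I + U) C = - (I + L)\<close>.  As \<open>det (I + U) = 1\<close>,
    \<open>det (C - \<lambda> I) = det ((I + U) (C - \<lambda> I)) = det (- (I + L) - \<lambda> (I + U))\<close>.
  The matrix on the right has diagonal entries \<open>- (1 + \<lambda>)\<close>, and off the diagonal it is supported on the
  edges of the graph: an edge contributes one entry \<open>- k\<^sub>u\<^sub>v\<close> and one entry \<open>- \<lambda> k\<^sub>v\<^sub>u\<close>, with the two
  roles distributed according to the order (\<open>coxeter_poly_eq_set_det\<close>).

  In a forest, a permutation moving every point to itself or to a neighbour has no cycle of
  length 3 or more, so it is an involution and its Leibniz term is a product of diagonal entries and
  of products of opposite entries.  These products are \<open>\<lambda> k\<^sub>u\<^sub>v k\<^sub>v\<^sub>u\<close> for every order, hence the order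
  of the reflections does not matter (\<open>coxeter_poly_acyclic\<close>), and all polynomials in the splitting
  formula may be computed from the entries of one and the same matrix.

  Finally, \<open>\<beta>\<close> is a leaf attached to \<open>\<alpha>\<close>.  A contributing permutation either fixes \<open>\<beta>\<close>, giving
  \<open>- (1 + \<lambda>)\<close> times the determinant over the remaining vertices, or interchanges \<open>\<alpha>\<close> and \<open>\<beta>\<close>, giving
  \<open>- \<lambda> k\<^sub>\<alpha>\<^sub>\<beta> k\<^sub>\<beta>\<^sub>\<alpha>\<close> times the determinant over the vertices other than \<open>\<alpha>\<close> and \<open>\<beta>\<close>
  (\<open>set_det_leaf\<close>).  Symmetrizability gives \<open>d\<^sub>\<alpha>\<^sub>\<beta> (\<alpha>, \<alpha>) = d\<^sub>\<beta>\<^sub>\<alpha> (\<beta>, \<beta>)\<close>, so when one of the weights is 1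
  the product of the weights is the ratio of the squared root lengths.
\<close>

section \<open>Determinants indexed by a finite set\<close>

text \<open>
  The Leibniz determinant with rows and columns indexed by the elements of a finite set, so that
  passing to a subgraph needs no renumbering of the vertices.
\<close>
definition set_det :: "'a set \<Rightarrow> ('a \<Rightarrow> 'a \<Rightarrow> 'b::comm_ring_1) \<Rightarrow> 'b" where
  "set_det V A = (\<Sum>p | p permutes V. of_int (sign p) * (\<Prod>v\<in>V. A v (p v)))"

lemma set_det_cong:
  assumes "\<And>u v. u \<in> V \<Longrightarrow> v \<in> V \<Longrightarrow> A u v = A' u v"
  shows "set_det V A = set_det V A'"
  unfolding set_det_def
  by (intro sum.cong refl arg_cong2[where f = "(*)"] prod.cong assms)
     (auto dest: permutes_in_image)

text \<open>
  Relabelling the indices along a bijection conjugates the permutations in the Leibniz sum and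
  preserves their signs.
\<close>
lemma det_mat_nth_eq_set_det:
  assumes "distinct vs"
  shows "det (mat (length vs) (length vs) (\<lambda>(i, j). A (vs ! i) (vs ! j))) = set_det (set vs) A"
proof -
  let ?n = "length vs" and ?f = "\<lambda>i. vs ! i"
  let ?m = "map_permutation {0..<?n} ?f"
  have bij: "bij_betw ?f {0..<?n} (set vs)"
    using bij_betw_nth[OF assms, of "{0..<?n}" "set vs"] by (simp add: atLeast0LessThan)
  then have inj: "inj_on ?f {0..<?n}"
    by (rule bij_betw_imp_inj_on)
  let ?g = "inv_into {0..<?n} ?f"
  have bij': "bij_betw ?g (set vs) {0..<?n}"
    using bij by (rule bij_betw_inv_into)
  have back_left: "?m (map_permutation (set vs) ?g p) = p" if "p permutes set vs" for p
    using bij' that by (rule map_permutation_compose_inv) (use bij in \<open>simp add: bij_betw_inv_into_right\<close>)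
  have back_right: "map_permutation (set vs) ?g (?m p) = p" if "p permutes {0..<?n}" for p
    using bij that by (rule map_permutation_compose_inv) (use bij in \<open>simp add: bij_betw_inv_into_left\<close>)
  have "set_det (set vs) A = (\<Sum>p | p permutes {0..<?n}.
      of_int (sign (?m p)) * (\<Prod>v\<in>set vs. A v (?m p v)))"
    unfolding set_det_def
    by (rule sum.reindex_bij_witness[where i = ?m and j = "map_permutation (set vs) ?g"])
      (use bij bij' in \<open>auto intro: map_permutation_permutes simp: back_left back_right\<close>)
  also have "\<dots> = (\<Sum>p | p permutes {0..<?n}.
      of_int (sign p) * (\<Prod>i = 0..<?n. A (vs ! i) (vs ! p i)))"
  proof (rule sum.cong)
    fix p assume "p \<in> {p. p permutes {0..<?n}}"
    then have p: "p permutes {0..<?n}" by simp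
    have "(\<Prod>v\<in>set vs. A v (?m p v)) = (\<Prod>i = 0..<?n. A (vs ! i) (?m p (vs ! i)))"
      by (rule prod.reindex_bij_betw[OF bij, symmetric])
    also have "\<dots> = (\<Prod>i = 0..<?n. A (vs ! i) (vs ! p i))"
      by (rule prod.cong) (simp_all add: map_permutation_apply[OF inj])
    finally show "of_int (sign (?m p)) * (\<Prod>v\<in>set vs. A v (?m p v)) =
        of_int (sign p) * (\<Prod>i = 0..<?n. A (vs ! i) (vs ! p i))"
      by (simp add: sign_map_permutation[OF inj p])
  qed simp
  also have "\<dots> = det (mat ?n ?n (\<lambda>(i, j). A (vs ! i) (vs ! j)))"
    by (subst det_def'[of _ ?n]) (auto intro!: sum.cong prod.cong dest: permutes_in_image)
  finally show ?thesis by simp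
qed

text \<open>
  The row and the column of \<open>b\<close> meet the rest of the matrix only at \<open>a\<close>.  A permutation with nonzero
  Leibniz term must therefore send \<open>b\<close> to \<open>b\<close> or to \<open>a\<close>; in the second case it must also send \<open>a\<close> to
  \<open>b\<close>, because the preimage of \<open>b\<close> is \<open>a\<close>, and the transposition accounts for the sign.
\<close>
lemma set_det_leaf:
  assumes fin: "finite V" and b: "b \<notin> V" and a: "a \<in> V"
    and row: "\<And>v. v \<in> V \<Longrightarrow> v \<noteq> a \<Longrightarrow> A b v = 0"
    and col: "\<And>v. v \<in> V \<Longrightarrow> v \<noteq> a \<Longrightarrow> A v b = 0"
  shows "set_det (insert b V) A = A b b * set_det V A - A a b * A b a * set_det (V - {a}) A"
proof -
  let ?t = "\<lambda>p. of_int (sign p) * (\<Prod>v\<in>insert b V. A v (p v))"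
  let ?s = "\<lambda>c. \<Sum>q | q permutes V. ?t (transpose b c \<circ> q)"
  have ab: "a \<noteq> b" using a b by auto
  have qb: "q b = b" if "q permutes V" for q
    using that b by (rule permutes_not_in)
  have leib: "(\<Prod>v\<in>insert b V. A v ((transpose b c \<circ> q) v)) =
      A b c * (\<Prod>v\<in>V. A v (transpose b c (q v)))" if "q permutes V" for c q
    using fin b by (simp add: qb[OF that])
  \<comment> \<open>Each permutation of the enlarged set is uniquely \<open>transpose b c \<circ> q\<close> with \<open>q\<close> fixing \<open>b\<close>; here \<open>c\<close> is the image of \<open>b\<close>.\<close>
  have s_b: "?s b = A b b * set_det V A"
    unfolding set_det_def sum_distrib_left
    by (rule sum.cong) (use leib[of _ b] in \<open>auto simp: algebra_simps\<close>)
  have s_a: "?s a = - (A a b * A b a * set_det (V - {a}) A)"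
  proof -
    \<comment> \<open>If \<open>q\<close> moves \<open>a\<close>, then the point \<open>v\<close> with \<open>q v = a\<close> is sent to \<open>b\<close> but is not \<open>a\<close>.\<close>
    have "?s a = (\<Sum>q | q permutes V - {a}. ?t (transpose b a \<circ> q))"
    proof (rule sum.mono_neutral_right)
      show "finite {q. q permutes V}" using fin by (rule finite_permutations)
      show "{q. q permutes V - {a}} \<subseteq> {q. q permutes V}"
        by (auto intro: permutes_subset)
      show "\<forall>q\<in>{q. q permutes V} - {q. q permutes V - {a}}. ?t (transpose b a \<circ> q) = 0"
      proof
        fix q assume "q \<in> {q. q permutes V} - {q. q permutes V - {a}}"
        then have q: "q permutes V" and nq: "\<not> q permutes V - {a}" by auto
        have "q a \<noteq> a"
        proof
          assume "q a = a"
          with q have "q permutes V - {a}"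
            by (intro permutes_superset[OF q]) auto
          with nq show False ..
        qed
        obtain v where v: "q v = a" using permutes_surj[OF q] by (metis surjD)
        then have "v \<in> V" using permutes_in_image[OF q, of v] a by simp
        moreover have "v \<noteq> a" using v \<open>q a \<noteq> a\<close> by auto
        ultimately have "A v (transpose b a (q v)) = 0" using col v by simp
        then have "(\<Prod>v\<in>V. A v (transpose b a (q v))) = 0"
          using fin \<open>v \<in> V\<close> by (intro prod_zero) auto
        then show "?t (transpose b a \<circ> q) = 0" by (simp only: leib[OF q]) simp
      qed
    qed
    also have "\<dots> = (\<Sum>q | q permutes V - {a}.
        - (A a b * A b a) * (of_int (sign q) * (\<Prod>v\<in>V - {a}. A v (q v))))"
    proof (rule sum.cong)
      fix q assume "q \<in> {q. q permutes V - {a}}"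
      then have q': "q permutes V - {a}" by simp
      then have q: "q permutes V" by (rule permutes_subset) auto
      have qa: "q a = a" using q' by (rule permutes_not_in) simp
      have "(\<Prod>v\<in>V. A v (transpose b a (q v))) =
          A a b * (\<Prod>v\<in>V - {a}. A v (transpose b a (q v)))"
        using fin a by (subst prod.remove[of V a]) (simp_all add: qa)
      also have "(\<Prod>v\<in>V - {a}. A v (transpose b a (q v))) = (\<Prod>v\<in>V - {a}. A v (q v))"
      proof (rule prod.cong)
        fix v assume "v \<in> V - {a}"
        then have "q v \<in> V - {a}" using permutes_in_image[OF q'] by blast
        then show "A v (transpose b a (q v)) = A v (q v)"
          using b by (auto simp: transpose_def)
      qed simp
      finally have prod: "(\<Prod>v\<in>insert b V. A v ((transpose b a \<circ> q) v)) =
          A b a * (A a b * (\<Prod>v\<in>V - {a}. A v (q v)))"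
        by (simp only: leib[OF q])
      have "permutation q" using q fin by (auto simp: permutation_permutes)
      then have "sign (transpose b a \<circ> q) = - sign q"
        using ab by (simp add: sign_compose permutation_swap_id sign_swap_id)
      then show "?t (transpose b a \<circ> q) =
          - (A a b * A b a) * (of_int (sign q) * (\<Prod>v\<in>V - {a}. A v (q v)))"
        by (simp only: prod) (simp add: algebra_simps)
    qed simp
    finally show ?thesis
      by (simp add: set_det_def sum_distrib_left sum_negf)
  qed
  have s_0: "?s c = 0" if "c \<in> V - {a}" for c
  proof (rule sum.neutral, rule ballI)
    fix q assume "q \<in> {q. q permutes V}"
    then have "q permutes V" by simp
    then show "?t (transpose b c \<circ> q) = 0" using that row by (simp only: leib) simp
  qed
  have "set_det (insert b V) A = (\<Sum>c\<in>insert b V. ?s c)"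
    unfolding set_det_def by (rule sum_over_permutations_insert[OF fin b])
  also have "\<dots> = ?s b + (?s a + (\<Sum>c\<in>V - {a}. ?s c))"
    by (subst sum.insert[OF fin b], subst sum.remove[OF fin a]) (rule refl)
  also have "(\<Sum>c\<in>V - {a}. ?s c) = 0"
    by (rule sum.neutral) (use s_0 in blast)
  finally show ?thesis by (simp only: s_a s_b) simp
qed

section \<open>Determinants supported on a forest\<close>

text \<open>
  If \<open>v\<close> were not fixed by the square of \<open>p\<close>, the orbit of \<open>v\<close> would be listed by \<open>p\<close> as a closed walk
  through at least 3 distinct vertices along edges.
\<close>
lemma acyclic_permutation_involution:
  assumes acyc: "acyclic_graph G" and p: "permutation p"
    and adj: "\<And>v. p v \<noteq> v \<Longrightarrow> adjacent G v (p v)"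
  shows "p (p v) = v"
proof (rule ccontr)
  assume neq: "p (p v) \<noteq> v"
  let ?n = "least_power p v"
  let ?c = "support p v"
  have n: "(p ^^ ?n) v = v" "?n > 0"
    using least_power_of_permutation[OF p] by auto
  have "?n \<noteq> 1" "?n \<noteq> 2"
    using n neq by (auto simp: numeral_2_eq_2)
  then have n3: "?n \<ge> 3" using n(2) by linarith
  have "distinct ?c" using cycle_of_permutation[OF p] .
  have step: "adjacent G ((p ^^ i) v) ((p ^^ Suc i) v)" for i
  proof -
    have "p ((p ^^ i) v) \<noteq> (p ^^ i) v"
    proof
      assume "p ((p ^^ i) v) = (p ^^ i) v"
      then have "(p ^^ i) (p v) = (p ^^ i) v"
        by (simp add: funpow_swap1)
      moreover have "inj (p ^^ i)"
        using p by (intro inj_fn bij_is_inj permutation_bijective)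
      ultimately have "p v = v" by (auto dest: injD)
      with neq show False by simp
    qed
    from adj[OF this] show ?thesis by simp
  qed
  have "successively (adjacent G) ?c"
    unfolding successively_conv_nth using step by simp
  moreover have "adjacent G (last ?c) (hd ?c)"
  proof -
    have "adjacent G ((p ^^ (?n - 1)) v) ((p ^^ Suc (?n - 1)) v)" by (rule step)
    moreover have "Suc (?n - 1) = ?n" using n(2) by simp
    ultimately have "adjacent G ((p ^^ (?n - 1)) v) v" using n(1) by metis
    then show ?thesis using n(2) by (simp add: last_map hd_map)
  qed
  ultimately show False
    using acyc \<open>distinct ?c\<close> n3 unfolding acyclic_graph_def by (metis length_map diff_zero length_upt)
qed

text \<open>
  Grouping the factors by the orbits of \<open>p\<close>, an orbit of size 1 contributes a diagonal entry and an
  orbit of size 2 contributes a product of opposite entries.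
\<close>
lemma prod_involution_cong:
  fixes A A' :: "'a \<Rightarrow> 'a \<Rightarrow> 'b::comm_monoid_mult"
  assumes fin: "finite V" and p: "p permutes V" and inv: "\<And>v. p (p v) = v"
    and diag: "\<And>v. v \<in> V \<Longrightarrow> A v v = A' v v"
    and off: "\<And>u v. u \<in> V \<Longrightarrow> v \<in> V \<Longrightarrow> u \<noteq> v \<Longrightarrow> A u v * A v u = A' u v * A' v u"
  shows "(\<Prod>v\<in>V. A v (p v)) = (\<Prod>v\<in>V. A' v (p v))"
proof -
  let ?o = "\<lambda>v. {v, p v}"
  have orbit: "{x \<in> V. ?o x = ?o v} = ?o v" if "v \<in> V" for v
    using that inv permutes_in_image[OF p] by (auto simp: doubleton_eq_iff)
  have "(\<Prod>x\<in>{x \<in> V. ?o x = S}. A x (p x)) = (\<Prod>x\<in>{x \<in> V. ?o x = S}. A' x (p x))"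
    if "S \<in> ?o ` V" for S
  proof -
    from that obtain v where v: "v \<in> V" and S: "S = ?o v" by blast
    have pv: "p v \<in> V" using v permutes_in_image[OF p] by simp
    show ?thesis
      unfolding S orbit[OF v]
      by (cases "p v = v") (use diag[OF v] off[OF v pv] in \<open>auto simp: inv\<close>)
  qed
  then show ?thesis
    by (subst (1 2) prod.image_gen[OF fin, where g = ?o]) (rule prod.cong[OF refl])
qed

text \<open>
  Only involutions have nonzero Leibniz terms when the matrix is supported on a forest, so opposite
  entries enter the determinant through their product alone.
\<close>
lemma set_det_acyclic_cong:
  assumes fin: "finite V" and acyc: "acyclic_graph G"
    and supp: "\<And>u v. u \<in> V \<Longrightarrow> v \<in> V \<Longrightarrow> u \<noteq> v \<Longrightarrow> \<not> adjacent G u v \<Longrightarrow> A u v = 0"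
    and supp': "\<And>u v. u \<in> V \<Longrightarrow> v \<in> V \<Longrightarrow> u \<noteq> v \<Longrightarrow> \<not> adjacent G u v \<Longrightarrow> A' u v = 0"
    and diag: "\<And>v. v \<in> V \<Longrightarrow> A v v = A' v v"
    and off: "\<And>u v. u \<in> V \<Longrightarrow> v \<in> V \<Longrightarrow> u \<noteq> v \<Longrightarrow> A u v * A v u = A' u v * A' v u"
  shows "set_det V A = set_det V A'"
  unfolding set_det_def
proof (rule sum.cong)
  fix p assume "p \<in> {p. p permutes V}"
  then have p: "p permutes V" by simp
  have "(\<Prod>v\<in>V. A v (p v)) = (\<Prod>v\<in>V. A' v (p v))"
  proof (cases "\<exists>v\<in>V. p v \<noteq> v \<and> \<not> adjacent G v (p v)")
    case True
    then obtain v where v: "v \<in> V" "p v \<noteq> v" "\<not> adjacent G v (p v)" by blast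
    then have "A v (p v) = 0" "A' v (p v) = 0"
      using supp supp' permutes_in_image[OF p] by metis+
    then have "(\<Prod>v\<in>V. A v (p v)) = 0" "(\<Prod>v\<in>V. A' v (p v)) = 0"
      using fin v(1) by (auto intro!: prod_zero)
    then show ?thesis by simp
  next
    case False
    have "p (p v) = v" for v
    proof (rule acyclic_permutation_involution[OF acyc])
      show "permutation p" using p fin by (auto simp: permutation_permutes)
      show "adjacent G v (p v)" if "p v \<noteq> v" for v
        using False that permutes_not_in[OF p] by blast
    qed
    then show ?thesis
      by (intro prod_involution_cong[OF fin p _ diag off])
  qed
  then show "of_int (sign p) * (\<Prod>v\<in>V. A v (p v)) = of_int (sign p) * (\<Prod>v\<in>V. A' v (p v))"
    by simp
qed simp

section \<open>The Coxeter polynomial as a determinant over the vertices\<close>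

lemma coxeter_Cons:
  "coxeter G (v # vs) z u =
     coxeter G vs z u - (if u = v then \<Sum>w\<in>verts G. real_of_int (cartan G v w) * coxeter G vs z w else 0)"
  by (simp add: coxeter_def simple_reflection_def simple_root_def)

lemma coxeter_append_notin:
  "u \<notin> set xs \<Longrightarrow> coxeter G (xs @ ys) z u = coxeter G ys z u"
proof (induction xs)
  case (Cons x xs)
  then show ?case by (simp add: coxeter_Cons)
qed simp

lemma coxeter_notin: "u \<notin> set xs \<Longrightarrow> coxeter G xs z u = z u"
  using coxeter_append_notin[of u xs G "[]" z] by (simp add: coxeter_def)

text \<open>
  The coordinate at a vertex is changed by its own reflection alone.  When that reflection is applied,
  the reflections of the later vertices in the list have already been applied, those of the earlier
  ones not yet: this is the entrywise form of \<open>(I + U) C = - (I + L)\<close>.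
\<close>
lemma coxeter_nth:
  assumes ord: "vertex_order G vs" and i: "i < length vs"
  shows "coxeter G vs z (vs ! i) = z (vs ! i) - (\<Sum>j<length vs. real_of_int (cartan G (vs ! i) (vs ! j)) *
           (if i < j then coxeter G vs z (vs ! j) else z (vs ! j)))"
proof -
  let ?n = "length vs" and ?v = "vs ! i" and ?ys = "drop (Suc i) vs"
  have dist: "distinct vs" and set: "set vs = verts G"
    using ord by (auto simp: vertex_order_def)
  have split: "vs = take i vs @ ?v # ?ys"
    using id_take_nth_drop[OF i] .
  have notin: "vs ! i' \<notin> set (take k vs)" if "k \<le> i'" "i' < ?n" for k i'
    using that dist by (auto simp: in_set_conv_nth nth_eq_iff_index_eq)
  have notin': "vs ! i' \<notin> set (drop k vs)" if "i' < k" "i' < ?n" for k i'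
    using that dist by (auto simp: in_set_conv_nth nth_eq_iff_index_eq)
  have later: "coxeter G ?ys z (vs ! j) = (if i < j then coxeter G vs z (vs ! j) else z (vs ! j))"
    if j: "j < ?n" for j
  proof (cases "i < j")
    case True
    have "coxeter G (take (Suc i) vs @ ?ys) z (vs ! j) = coxeter G ?ys z (vs ! j)"
      by (rule coxeter_append_notin[OF notin]) (use True j in auto)
    then show ?thesis using True by simp
  next
    case False
    then show ?thesis using coxeter_notin[OF notin'[of j "Suc i"], of G z] j by simp
  qed
  have "coxeter G vs z ?v = coxeter G (?v # ?ys) z ?v"
    by (subst split, rule coxeter_append_notin[OF notin]) (use i in auto)
  also have "\<dots> = coxeter G ?ys z ?v -
      (\<Sum>w\<in>verts G. real_of_int (cartan G ?v w) * coxeter G ?ys z w)"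
    by (simp add: coxeter_Cons)
  also have "(\<Sum>w\<in>verts G. real_of_int (cartan G ?v w) * coxeter G ?ys z w) =
      (\<Sum>j<?n. real_of_int (cartan G ?v (vs ! j)) * coxeter G ?ys z (vs ! j))"
    by (rule sum.reindex_bij_betw[symmetric])
       (use bij_betw_nth[OF dist, of "{..<?n}" "verts G"] set in auto)
  also have "\<dots> = (\<Sum>j<?n. real_of_int (cartan G ?v (vs ! j)) *
           (if i < j then coxeter G vs z (vs ! j) else z (vs ! j)))"
    by (rule sum.cong) (use later in auto)
  finally show ?thesis using later[OF i] by simp
qed

text \<open>
  The matrix \<open>- (I + L) - \<lambda> (I + U)\<close>, where \<open>L\<close> and \<open>U\<close> are the strict lower and upper triangular parts
  of the Cartan matrix for the vertex order given by the positions \<open>pos\<close>.  Keeping the positions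
  as a parameter allows one numbering to be used for a graph and all its subgraphs.
\<close>
definition pencil_entry :: "'a valued_graph \<Rightarrow> ('a \<Rightarrow> nat) \<Rightarrow> 'a \<Rightarrow> 'a \<Rightarrow> real poly" where
  "pencil_entry G pos u v =
     (if u = v then - [:1, 1:]
      else if pos u < pos v then [:0, - real_of_int (cartan G u v):]
      else [:- real_of_int (cartan G u v):])"

text \<open>
  Multiplying \<open>C - \<lambda> I\<close> on the left by the unipotent matrix \<open>I + U\<close> preserves the determinant and, by
  \<open>(I + U) C = - (I + L)\<close>, turns the matrix into \<open>- (I + L) - \<lambda> (I + U)\<close>.
\<close>
lemma coxeter_poly_eq_set_det:
  assumes ord: "vertex_order G vs" and pos: "\<And>i. i < length vs \<Longrightarrow> pos (vs ! i) = i"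
  shows "coxeter_poly G vs = set_det (verts G) (pencil_entry G pos)"
proof -
  let ?n = "length vs"
  let ?K = "\<lambda>i j. real_of_int (cartan G (vs ! i) (vs ! j))"
  let ?u = "\<lambda>i j. if i = j then 1 else if i < j then ?K i j else 0"
  let ?N = "mat ?n ?n (\<lambda>(i, j). [:?u i j:])"
  let ?M = "map_mat (\<lambda>c. [:c:]) (coxeter_mat G vs) - [:0, 1:] \<cdot>\<^sub>m 1\<^sub>m ?n"
  let ?P = "mat ?n ?n (\<lambda>(i, j). pencil_entry G pos (vs ! i) (vs ! j))"
  let ?C = "\<lambda>i j. coxeter G vs (simple_root (vs ! j)) (vs ! i)"
  have dist: "distinct vs" and set: "set vs = verts G"
    using ord by (auto simp: vertex_order_def)
  have root: "simple_root (vs ! j) (vs ! i) = (if i = j then 1 else 0)" if "i < ?n" "j < ?n" for i j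
    using that dist by (simp add: simple_root_def nth_eq_iff_index_eq)
  \<comment> \<open>The entries of \<open>(I + U) C = - (I + L)\<close>.\<close>
  have eq: "(\<Sum>k<?n. ?u i k * ?C k j) = (if i = j then - 1 else if j < i then - ?K i j else 0)"
    if i: "i < ?n" and j: "j < ?n" for i j
  proof -
    have "(\<Sum>k<?n. ?K i k * (if i < k then ?C k j else if k = j then 1 else 0)) =
        (\<Sum>k<?n. (if i < k then ?K i k * ?C k j else 0) + (if k = j then (if i < j then 0 else ?K i j) else 0))"
      by (rule sum.cong) auto
    also have "\<dots> = (\<Sum>k<?n. if i < k then ?K i k * ?C k j else 0) + (if i < j then 0 else ?K i j)"
      using j by (simp add: sum.distrib)
    finally have 1: "?C i j = (if i = j then 1 else 0) -
        ((\<Sum>k<?n. if i < k then ?K i k * ?C k j else 0) + (if i < j then 0 else ?K i j))"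
      using coxeter_nth[OF ord i, of "simple_root (vs ! j)"] i j by (simp add: root cong: if_cong)
    have "(\<Sum>k<?n. ?u i k * ?C k j) =
        (\<Sum>k<?n. (if i < k then ?K i k * ?C k j else 0) + (if k = i then ?C i j else 0))"
      by (rule sum.cong) auto
    also have "\<dots> = (\<Sum>k<?n. if i < k then ?K i k * ?C k j else 0) + ?C i j"
      using i by (simp add: sum.distrib)
    finally show ?thesis
      using 1 by (auto simp: cartan_def)
  qed
  have "?N * ?M = ?P"
  proof (rule eq_matI)
    fix i j assume "i < dim_row ?P" "j < dim_col ?P"
    then have i: "i < ?n" and j: "j < ?n" by auto
    have "(?N * ?M) $$ (i, j) =
        (\<Sum>k<?n. [:?u i k:] * ([:?C k j:] - [:0, 1:] * (if k = j then 1 else 0)))"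
      using i j by (simp add: scalar_prod_def coxeter_mat_def atLeast0LessThan)
    also have "\<dots> = (\<Sum>k<?n. [:?u i k * ?C k j:] - (if k = j then [:0, ?u i j:] else 0))"
      by (rule sum.cong) (auto simp: algebra_simps)
    also have "\<dots> = [:\<Sum>k<?n. ?u i k * ?C k j:] - [:0, ?u i j:]"
      using j by (simp add: sum_subtractf sum_to_poly)
    also have "\<dots> = ?P $$ (i, j)"
      using i j dist by (simp only: eq[OF i j]) (auto simp: pencil_entry_def pos nth_eq_iff_index_eq)
    finally show "(?N * ?M) $$ (i, j) = ?P $$ (i, j)" .
  qed (auto simp: coxeter_mat_def)
  moreover have "det (?N * ?M) = det ?N * det ?M"
    by (rule det_mult[of _ ?n]) (auto simp: coxeter_mat_def)
  moreover have "det ?N = 1"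
  proof -
    have "det ?N = prod_list (diag_mat ?N)"
      by (rule det_upper_triangular[of _ ?n]) (auto simp: upper_triangular_def)
    also have "diag_mat ?N = replicate ?n 1"
      by (auto simp: diag_mat_def intro!: nth_equalityI)
    finally show ?thesis by simp
  qed
  ultimately have "coxeter_poly G vs = det ?P"
    by (simp add: coxeter_poly_def)
  also have "\<dots> = set_det (verts G) (pencil_entry G pos)"
    using det_mat_nth_eq_set_det[OF dist, of "pencil_entry G pos"] set by simp
  finally show ?thesis .
qed

lemma vertex_order_pos:
  assumes "vertex_order G vs"
  obtains pos where "\<And>i. i < length vs \<Longrightarrow> pos (vs ! i) = i" "inj_on pos (verts G)"
proof -
  let ?pos = "inv_into {..<length vs} ((!) vs)"
  have "bij_betw ((!) vs) {..<length vs} (verts G)"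
    using assms by (intro bij_betw_nth) (auto simp: vertex_order_def)
  then show thesis
    by (intro that[of ?pos]) (auto simp: bij_betw_inv_into_left bij_betw_def intro: inj_on_inv_into)
qed

lemma pencil_entry_mult_swap:
  assumes "inj_on pos (verts G)" "u \<in> verts G" "v \<in> verts G" "u \<noteq> v"
  shows "pencil_entry G pos u v * pencil_entry G pos v u =
    [:0, real_of_int (cartan G u v * cartan G v u):]"
proof -
  have "pos u \<noteq> pos v" using assms by (auto dest: inj_onD)
  then show ?thesis using \<open>u \<noteq> v\<close> by (auto simp: pencil_entry_def)
qed

text \<open>
  For a forest the numbering of the vertices is independent of the order of the reflections,
  because changing it only moves the factor \<open>\<lambda>\<close> between opposite entries.
\<close>
lemma coxeter_poly_acyclic:
  assumes G: "valued_graph G" and acyc: "acyclic_graph G"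
    and ord: "vertex_order G vs" and inj: "inj_on pos (verts G)"
  shows "coxeter_poly G vs = set_det (verts G) (pencil_entry G pos)"
proof -
  obtain pos' where pos': "\<And>i. i < length vs \<Longrightarrow> pos' (vs ! i) = i" and inj': "inj_on pos' (verts G)"
    by (rule vertex_order_pos[OF ord]) (rule that)
  have zero: "pencil_entry G f u v = 0"
    if "u \<in> verts G" "v \<in> verts G" "u \<noteq> v" "\<not> adjacent G u v" for f u v
    using that by (simp add: pencil_entry_def adjacent_def cartan_def)
  have "set_det (verts G) (pencil_entry G pos') = set_det (verts G) (pencil_entry G pos)"
    by (rule set_det_acyclic_cong[OF _ acyc])
       (use G in \<open>auto simp: zero pencil_entry_mult_swap[OF inj] pencil_entry_mult_swap[OF inj'] valued_graph_def\<close>,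
        simp add: pencil_entry_def)
  then show ?thesis
    using coxeter_poly_eq_set_det[OF ord pos'] by simp
qed

text \<open>
  The polynomials of a forest and of its induced subgraphs are all read off from one matrix.  The
  subgraph is described by its vertices and the weights between them, since deleting an edge
  leaves weight functions that differ outside the vertex set.
\<close>
lemma coxeter_poly_induced_subgraph:
  assumes G: "valued_graph G" and acyc: "acyclic_graph G"
    and sub: "verts H \<subseteq> verts G"
    and wt: "\<And>u v. u \<in> verts H \<Longrightarrow> v \<in> verts H \<Longrightarrow> wt H u v = wt G u v"
    and ord: "vertex_order H vs" and inj: "inj_on pos (verts G)"
  shows "coxeter_poly H vs = set_det (verts H) (pencil_entry G pos)"
proof -
  have adj: "adjacent G u v" if "adjacent H u v" for u v
    using that sub wt by (auto simp: adjacent_def)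
  have "valued_graph H"
    using G sub unfolding valued_graph_def by (auto simp: wt intro: finite_subset)
  moreover have "acyclic_graph H"
    using acyc adj unfolding acyclic_graph_def by (meson successively_mono)
  ultimately have "coxeter_poly H vs = set_det (verts H) (pencil_entry H pos)"
    using coxeter_poly_acyclic ord inj_on_subset[OF inj sub] by blast
  also have "\<dots> = set_det (verts H) (pencil_entry G pos)"
    by (rule set_det_cong) (simp add: pencil_entry_def cartan_def wt)
  finally show ?thesis .
qed

lemma coxeter_poly_leaf:
  fixes G H :: "'a valued_graph"
  assumes G: "valued_graph G" and acyc: "acyclic_graph G"
    and adj: "adjacent G a b"
    and leaf: "\<And>v. adjacent G b v \<Longrightarrow> v = a"
    and H: "verts H = verts G - {b}"
    and wt: "\<And>u v. u \<in> verts H \<Longrightarrow> v \<in> verts H \<Longrightarrow> wt H u v = wt G u v"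
    and ord: "vertex_order G vs" and ord1: "vertex_order H vs1"
    and ord2: "vertex_order (del_vert H a) vs2"
  shows "coxeter_poly G vs = - [:1, 1:] * coxeter_poly H vs1
    - [:0, real_of_int (cartan G a b * cartan G b a):] * coxeter_poly (del_vert H a) vs2"
proof -
  obtain pos :: "'a \<Rightarrow> nat" where inj: "inj_on pos (verts G)"
    using finite_imp_inj_to_nat_seg[of "verts G"] G by (auto simp: valued_graph_def)
  let ?A = "pencil_entry G pos"
  have a: "a \<in> verts G" and b: "b \<in> verts G" and ab: "a \<noteq> b"
    using adj G by (auto simp: adjacent_def valued_graph_def)
  have G': "verts G = insert b (verts H)" using H b by auto
  have no_edge: "wt G b v = 0" "wt G v b = 0" if "v \<in> verts H" "v \<noteq> a" for v
    using leaf[of v] that G b H by (auto simp: adjacent_def valued_graph_def)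
  have "coxeter_poly G vs = set_det (insert b (verts H)) ?A"
    using coxeter_poly_acyclic[OF G acyc ord inj] G' by simp
  also have "\<dots> = ?A b b * set_det (verts H) ?A - ?A a b * ?A b a * set_det (verts H - {a}) ?A"
  proof (rule set_det_leaf)
    show "finite (verts H)" using G H by (simp add: valued_graph_def)
    show "?A b v = 0" "?A v b = 0" if "v \<in> verts H" "v \<noteq> a" for v
      using no_edge[OF that] that H by (auto simp: pencil_entry_def cartan_def)
  qed (use H a ab in auto)
  also have "set_det (verts H) ?A = coxeter_poly H vs1"
    using coxeter_poly_induced_subgraph[OF G acyc _ wt ord1 inj] H by simp
  also have "set_det (verts H - {a}) ?A = coxeter_poly (del_vert H a) vs2"
    using coxeter_poly_induced_subgraph[OF G acyc _ _ ord2 inj] H wt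
    by (force simp: del_vert_def)
  also have "?A a b * ?A b a = [:0, real_of_int (cartan G a b * cartan G b a):]"
    by (rule pencil_entry_mult_swap[OF inj a b ab])
  finally show ?thesis by (simp add: pencil_entry_def)
qed

section \<open>The ratio of root lengths\<close>

text \<open>
  The two Cartan entries of an edge express the same inner product, whence
  \<open>d\<^sub>a\<^sub>b (a, a) = d\<^sub>b\<^sub>a (b, b)\<close>.  If one weight is 1, the root at its first index is at least as
  long as the other one, and the other weight is the ratio of the squared lengths.
\<close>
lemma length_ratio_eq_weight_product:
  assumes G: "valued_graph G" and B: "symmetrizing_form G B" and adj: "adjacent G a b"
    and wt1: "wt G a b = 1 \<or> wt G b a = 1"
  shows "real_of_int (cartan G a b * cartan G b a) = length_ratio B a b"
proof -
  have V: "a \<in> verts G" "b \<in> verts G" and ab: "a \<noteq> b" and pos: "wt G a b > 0" "wt G b a > 0"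
    using adj G by (fastforce simp: adjacent_def valued_graph_def)+
  have B_pos: "B a a > 0" "B b b > 0" and sym: "B a b = B b a"
    using B V by (auto simp: symmetrizing_form_def)
  have "real_of_int (cartan G a b) = 2 * B a b / B a a" "real_of_int (cartan G b a) = 2 * B b a / B b b"
    using B V unfolding symmetrizing_form_def by blast+
  then have "real (wt G a b) * B a a = - 2 * B a b" "real (wt G b a) * B b b = - 2 * B b a"
    using ab B_pos by (auto simp: cartan_def field_simps)
  then have eq: "real (wt G a b) * B a a = real (wt G b a) * B b b"
    using sym by simp
  have ge: "x \<le> real n * x" if "n > 0" "x > 0" for n and x :: real
    using that by simp
  from wt1 show ?thesis
  proof
    assume 1: "wt G a b = 1"
    then have "B a a = real (wt G b a) * B b b" using eq by simp
    then show ?thesis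
      using 1 ab B_pos ge[OF pos(2) B_pos(2)] by (simp add: length_ratio_def cartan_def max_def min_def)
  next
    assume 1: "wt G b a = 1"
    then have "B b b = real (wt G a b) * B a a" using eq by simp
    then show ?thesis
      using 1 ab B_pos ge[OF pos(1) B_pos(1)] by (simp add: length_ratio_def cartan_def max_def min_def)
  qed
qed

section \<open>Splitting off an end point of a tree\<close>

lemma component_singleton_leaf:
  assumes G: "valued_graph G" and single: "verts (component (del_edge G a b) b) = {b}"
    and adj: "adjacent G b v"
  shows "v = a"
proof (rule ccontr)
  assume "v \<noteq> a"
  have "v \<noteq> b" using G adj by (auto simp: adjacent_def valued_graph_def)
  with adj \<open>v \<noteq> a\<close> have "adjacent (del_edge G a b) b v"
    by (auto simp: adjacent_def del_edge_def doubleton_eq_iff)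
  then have "v \<in> verts (component (del_edge G a b) b)"
    using adj by (auto simp: component_def del_edge_def adjacent_def)
  with single \<open>v \<noteq> b\<close> show False by simp
qed

text \<open>
  A walk from \<open>a\<close> can enter the leaf \<open>b\<close> only to return to \<open>a\<close>, so removing the edge cuts off nothing
  but \<open>b\<close>.
\<close>
lemma component_complement_of_leaf:
  assumes conn: "connected_graph G" and split: "splitting_edge G a b"
    and leaf: "\<And>v. adjacent G b v \<Longrightarrow> v = a"
  shows "verts (component (del_edge G a b) a) = verts G - {b}"
proof -
  let ?R = "adjacent (del_edge G a b)"
  have reach: "u = b \<or> ?R\<^sup>*\<^sup>* a u" if "(adjacent G)\<^sup>*\<^sup>* a u" for u
    using that
  proof induction
    case (step y z)
    consider "z = b" | "z \<noteq> b" "y = b" | "z \<noteq> b" "y \<noteq> b" by blast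
    then show ?case
    proof cases
      \<comment> \<open>The walk has just left \<open>b\<close>, so it is back at its origin \<open>a\<close>.\<close>
      case 2
      then show ?thesis using leaf step.hyps(2) by auto
    next
      case 3
      then have "?R y z"
        using step.hyps(2) by (auto simp: adjacent_def del_edge_def doubleton_eq_iff)
      then show ?thesis using step.IH 3 by (auto intro: rtranclp.rtrancl_into_rtrancl)
    qed simp
  qed simp
  have "a \<in> verts G" "\<not> ?R\<^sup>*\<^sup>* a b"
    using split by (auto simp: splitting_edge_def adjacent_def)
  then show ?thesis
    using reach conn by (auto simp: component_def del_edge_def connected_graph_def)
qed

theorem corollary4p9:
  fixes \<Gamma> \<Gamma>1 \<Gamma>2 :: "'a valued_graph"
    and B :: "'a \<Rightarrow> 'a \<Rightarrow> real"
    and \<alpha> \<beta> :: 'a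
    and vs vs1 vs2 :: "'a list"
    and \<rho> :: real
  assumes "valued_tree \<Gamma>"
    and "symmetrizing_form \<Gamma> B"
    and "splitting_edge \<Gamma> \<alpha> \<beta>"
    and "sqrt (B \<alpha> \<alpha>) \<noteq> sqrt (B \<beta> \<beta>)"
    and "\<Gamma>1 = component (del_edge \<Gamma> \<alpha> \<beta>) \<alpha>"
    and "\<Gamma>2 = component (del_edge \<Gamma> \<alpha> \<beta>) \<beta>"
    and "verts \<Gamma>2 = {\<beta>}"
    and "vertex_order \<Gamma> vs"
    and "vertex_order \<Gamma>1 vs1"
    and "vertex_order (del_vert \<Gamma>1 \<alpha>) vs2"
    and "\<rho> = real_of_int (cartan \<Gamma> \<alpha> \<beta> * cartan \<Gamma> \<beta> \<alpha>)"
  shows "coxeter_poly \<Gamma> vs =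
           - [:1, 1:] * coxeter_poly \<Gamma>1 vs1
           - [:0, \<rho>:] * coxeter_poly (del_vert \<Gamma>1 \<alpha>) vs2
         \<and> (wt \<Gamma> \<alpha> \<beta> = 1 \<or> wt \<Gamma> \<beta> \<alpha> = 1 \<longrightarrow> \<rho> = length_ratio B \<alpha> \<beta>)"
proof -
  have \<Gamma>: "valued_graph \<Gamma>" "connected_graph \<Gamma>" "acyclic_graph \<Gamma>"
    using assms(1) by (auto simp: valued_tree_def)
  have adj: "adjacent \<Gamma> \<alpha> \<beta>"
    using assms(3) by (simp add: splitting_edge_def)
  have leaf: "v = \<alpha>" if "adjacent \<Gamma> \<beta> v" for v
    using component_singleton_leaf[OF \<Gamma>(1) _ that] assms(6,7) by simp
  have verts: "verts \<Gamma>1 = verts \<Gamma> - {\<beta>}"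
    unfolding assms(5) by (rule component_complement_of_leaf[OF \<Gamma>(2) assms(3) leaf])
  have wt: "wt \<Gamma>1 u v = wt \<Gamma> u v" if "u \<in> verts \<Gamma>1" "v \<in> verts \<Gamma>1" for u v
    using that unfolding verts by (auto simp: assms(5) component_def del_edge_def doubleton_eq_iff)
  show ?thesis
    using coxeter_poly_leaf[OF \<Gamma>(1,3) adj leaf verts wt assms(8-10)]
      length_ratio_eq_weight_product[OF \<Gamma>(1) assms(2) adj] assms(11) by simp
qed

end
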